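(* Let $p$ be a prime and let $g(x)\in\mathbb{Z}[x]$ be a polynomial. Then the number of integers $x$ with $1\le x\le p(p-1)$ and $p\nmid x$ satisfying $$x^{g(x)}\equiv x \pmod p$$ is $$\sum_{x_0=1}^{p-1}\gcd(p-1,\,g(x_0)-1)=\sum_{d\mid p-1}\phi(d)\,\frac{p-1}{d}\,N_{g-1}(d).$$
   Context: $\phi$ is the Euler phi function. For a positive integer $d$, $N_{g-1}(d)$ is the number of solutions $z\in\mathbb{Z}/d\mathbb{Z}$ of $g(z)-1\equiv 0\pmod d$. If $g(x)$ is negative, $x^{g(x)}$ modulo $p$ is computed using the inverse of $x$ modulo $p$ (recall $p\nmid x$). Convention: $\gcd(m,0)=m$. *)

theory Defs
  imports "HOL-Number_Theory.Number_Theory" "HOL-Computational_Algebra.Polynomial"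
begin

text \<open>
  An integer representing \<open>x\<^sup>e\<close> modulo \<open>p\<close> for an integer exponent \<open>e\<close>; only its residue class
  modulo \<open>p\<close> is relevant. It is meaningful for negative \<open>e\<close> only if \<open>x\<close> is coprime to \<open>p\<close>.
\<close>

definition power_mod_int :: "int \<Rightarrow> int \<Rightarrow> int \<Rightarrow> int" where
  "power_mod_int p x e =
     (if e \<ge> 0 then x ^ nat e else modular_inverse p x ^ nat (- e))"

text \<open>
  The number of roots of \<open>f\<close> in \<open>\<int>/d\<int>\<close>, counted on the representatives \<open>0, \<dots>, d - 1\<close>; it is
  intended for \<open>d > 0\<close>.
\<close>

definition num_roots_mod :: "int poly \<Rightarrow> nat \<Rightarrow> nat" where
  "num_roots_mod f d = card {z \<in> {0..<int d}. [poly f z = 0] (mod int d)}"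

end

theory Submission
  imports Defs
begin

text \<open>
  If \<open>p\<close> does not divide \<open>x\<close>, then \<open>x\<^sup>e \<equiv> x\<close> modulo \<open>p\<close> says that the order of \<open>x\<close> modulo \<open>p\<close> divides \<open>e - 1\<close>,
  whatever the sign of \<open>e\<close> (\<open>power_mod_int_cong_self_iff\<close>). As that order divides \<open>p - 1\<close>, the
  condition with \<open>e = g(x)\<close> depends on the base \<open>x\<close> only modulo \<open>p\<close> and on the argument \<open>x\<close> of \<open>g\<close>
  only modulo \<open>p - 1\<close>. These moduli are coprime, so by the Chinese remainder theorem the two residues
  run independently over all pairs while \<open>x\<close> runs over an interval of length \<open>p (p - 1)\<close>
  (\<open>card_residue_pairs\<close>). For a fixed residue \<open>x\<^sub>0\<close> modulo \<open>p - 1\<close>, the admissible bases are the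
  \<open>gcd(p - 1, g(x\<^sub>0) - 1)\<close> units whose order divides \<open>g(x\<^sub>0) - 1\<close> (\<open>card_ord_dvd_eq_gcd\<close>), which
  gives the first formula.

  The second formula holds with any integer polynomial in place of \<open>g - 1\<close> and any positive integer
  in place of \<open>p - 1\<close> (\<open>sum_gcd_poly_eq_sum_divisors\<close>). Each gcd is written as the sum of \<open>\<phi>(d)\<close>
  over the common divisors \<open>d\<close>, and the order of summation is exchanged; the number of arguments at
  which the polynomial value is divisible by \<open>d\<close> is then read off from one period of length \<open>d\<close>.
\<close>

section \<open>Powers that fix a unit modulo a prime\<close>

lemma cong_poly_int:
  fixes f :: "int poly"
  assumes "[a = b] (mod m)"
  shows "[poly f a = poly f b] (mod m)"
  by (induction f) (simp_all add: assms cong_add cong_mult)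

lemma cong_power_nat_abs_iff_ord_dvd:
  fixes p :: nat and x e :: int
  assumes "p > 0"
  shows "[x ^ nat \<bar>e\<bar> = 1] (mod int p) \<longleftrightarrow> int (ord p (nat (x mod int p))) dvd e"
proof -
  define y where "y = nat (x mod int p)"
  have "[x = int y] (mod int p)"
    using assms by (simp add: y_def cong_def)
  then have "[x ^ nat \<bar>e\<bar> = int (y ^ nat \<bar>e\<bar>)] (mod int p)"
    by (simp add: cong_pow)
  then have "[x ^ nat \<bar>e\<bar> = 1] (mod int p) \<longleftrightarrow> [int (y ^ nat \<bar>e\<bar>) = int 1] (mod int p)"
    by (simp add: cong_def)
  also have "\<dots> \<longleftrightarrow> ord p y dvd nat \<bar>e\<bar>"
    by (simp only: cong_int_iff ord_divides)
  also have "\<dots> \<longleftrightarrow> int (ord p y) dvd e"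
    by (metis dvd_abs_iff int_dvd_int_iff int_nat_eq abs_ge_zero)
  finally show ?thesis
    by (simp add: y_def)
qed

text \<open>
  For \<open>e \<ge> 1\<close> cancel one factor \<open>x\<close>; for \<open>e \<le> 0\<close> multiply both sides by the unit \<open>x ^ (- e)\<close>. Either way
  the condition becomes that \<open>x\<close> raised to \<open>\<bar>e - 1\<bar>\<close> is 1.
\<close>

lemma power_mod_int_cong_self_iff:
  fixes p :: nat and x e :: int
  assumes "prime p" and "\<not> int p dvd x"
  shows "[power_mod_int (int p) x e = x] (mod int p) \<longleftrightarrow>
           int (ord p (nat (x mod int p))) dvd e - 1"
proof -
  have cop: "coprime x (int p)"
    using assms by (metis coprime_commute prime_imp_coprime prime_nat_int_transfer)
  have "[power_mod_int (int p) x e = x] (mod int p) \<longleftrightarrow> [x ^ nat \<bar>e - 1\<bar> = 1] (mod int p)"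
  proof (cases "e \<ge> 1")
    case True
    then have "power_mod_int (int p) x e = x * x ^ nat \<bar>e - 1\<bar>"
      by (simp add: power_mod_int_def flip: power_Suc) (simp add: Suc_nat_eq_nat_zadd1)
    then show ?thesis
      using cong_mult_lcancel[OF cop, of "x ^ nat \<bar>e - 1\<bar>" 1] by simp
  next
    case False
    define k where "k = nat (- e)"
    define u where "u = modular_inverse (int p) x"
    have pw: "power_mod_int (int p) x e = u ^ k"
      using False by (cases "e = 0") (simp_all add: power_mod_int_def k_def u_def)
    have "[x * u = 1] (mod int p)"
      unfolding u_def using cop by (rule cong_modular_inverse1)
    then have "[x ^ k * u ^ k = 1] (mod int p)"
      using cong_pow[of "x * u" 1 "int p" k] by (simp add: power_mult_distrib)
    moreover have "[u ^ k = x] (mod int p) \<longleftrightarrow> [x ^ k * u ^ k = x ^ k * x] (mod int p)"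
      using cop by (intro cong_mult_lcancel[symmetric]) simp
    moreover have "nat \<bar>e - 1\<bar> = Suc k"
      using False by (simp add: k_def)
    ultimately show ?thesis
      by (auto simp: pw cong_def mult.commute)
  qed
  also have "\<dots> \<longleftrightarrow> int (ord p (nat (x mod int p))) dvd e - 1"
    using assms(1) by (intro cong_power_nat_abs_iff_ord_dvd prime_gt_0_nat)
  finally show ?thesis .
qed

section \<open>The gcd as a sum of totients, and as a number of units\<close>

text \<open>
  Gauss's identity \<open>(\<Sum>d | d dvd k. \<phi>(d)) = k\<close> at \<open>k = gcd(n, m)\<close>, whose divisors are
  the common divisors of \<open>n\<close> and \<open>m\<close>. Both formulas of the theorem rest on it.
\<close>

lemma gcd_eq_sum_totient:
  fixes n :: nat and m :: int
  shows "gcd (int n) m = int (\<Sum>d | d dvd n \<and> int d dvd m. totient d)"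
proof -
  have "gcd (int n) m = int (gcd n (nat \<bar>m\<bar>))"
    by (metis gcd_abs2_int gcd_int_int_eq int_nat_eq abs_ge_zero)
  also have "gcd n (nat \<bar>m\<bar>) = (\<Sum>d | d dvd gcd n (nat \<bar>m\<bar>). totient d)"
    by (rule totient_divisor_sum[symmetric])
  also have "{d. d dvd gcd n (nat \<bar>m\<bar>)} = {d. d dvd n \<and> int d dvd m}"
    by (auto simp flip: int_dvd_int_iff)
  finally show ?thesis .
qed

text \<open>
  The unit group modulo \<open>p\<close> is cyclic, so it has \<open>\<phi>(d)\<close> elements of each order \<open>d\<close> dividing \<open>p - 1\<close>.
  Adding these numbers over those \<open>d\<close> that also divide \<open>m\<close> gives the gcd.
\<close>

lemma card_ord_dvd_eq_gcd:
  fixes p :: nat and m :: int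
  assumes "prime p"
  shows "int (card {y \<in> totatives p. int (ord p y) dvd m}) = gcd (int p - 1) m"
proof -
  have p: "p > 1"
    using assms by (rule prime_gt_1_nat)
  define D where "D = {d. d dvd p - 1 \<and> int d dvd m}"
  have finD: "finite D"
    using p unfolding D_def by (intro finite_subset[OF _ finite_divisors_nat[of "p - 1"]]) auto
  have ord_dvd: "ord p y dvd p - 1" if "y \<in> totatives p" for y
    using that order_divides_totient[of p y] assms
    by (auto simp: totatives_def coprime_commute totient_prime)
  have "{y \<in> totatives p. int (ord p y) dvd m} = (\<Union>d\<in>D. {y \<in> totatives p. ord p y = d})"
    using ord_dvd by (auto simp: D_def)
  also have "card \<dots> = (\<Sum>d\<in>D. card {y \<in> totatives p. ord p y = d})"
    using finD by (subst card_UN_disjoint) auto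
  also have "\<dots> = (\<Sum>d\<in>D. totient d)"
    using prime_card_elements_with_ord_eq_totient[OF p assms]
    by (intro sum.cong) (auto simp: D_def)
  finally show ?thesis
    using gcd_eq_sum_totient[of "p - 1" m] p by (simp add: D_def of_nat_diff)
qed

section \<open>Counting by residues\<close>

text \<open>
  The Chinese remainder theorem for the coprime moduli \<open>q\<close> and \<open>q - 1\<close>, as a count. The residue modulo
  \<open>q - 1\<close> is represented in \<open>{1..q - 1}\<close> rather than \<open>{0..q - 2}\<close>, which accounts for the shifts by 1.
\<close>

lemma card_residue_pairs:
  fixes q :: int and Q :: "int \<Rightarrow> int \<Rightarrow> bool"
  assumes "q > 1"
  shows "card {x \<in> {1..q * (q - 1)}. \<not> q dvd x \<and> Q ((x - 1) mod (q - 1) + 1) (x mod q)} =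
           (\<Sum>a = 1..q - 1. card {y \<in> {1..q - 1}. Q a y})"
proof -
  let ?S = "{x \<in> {1..q * (q - 1)}. \<not> q dvd x \<and> Q ((x - 1) mod (q - 1) + 1) (x mod q)}"
  let ?T = "SIGMA a:{1..q - 1}. {y \<in> {1..q - 1}. Q a y}"
  define F where "F = (\<lambda>x::int. ((x - 1) mod (q - 1) + 1, x mod q))"
  \<comment> \<open>Since \<open>q \<equiv> 1\<close> modulo \<open>q - 1\<close> and \<open>-(q - 1) \<equiv> 1\<close> modulo \<open>q\<close>, the number \<open>q a - (q - 1) y\<close> has
      the residues \<open>a\<close> and \<open>y\<close>; it is then moved into \<open>{1..q (q - 1)}\<close>.\<close>
  define G where "G = (\<lambda>(a, y). (q * a - (q - 1) * y - 1) mod (q * (q - 1)) + 1)"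
  have pos: "q * (q - 1) > 0"
    using assms by simp
  have G1: "(G (a, y) - 1) mod (q - 1) = (a - 1) mod (q - 1)" for a y
  proof -
    have "(G (a, y) - 1) mod (q - 1) = (q * a - (q - 1) * y - 1) mod (q - 1)"
      by (simp add: G_def mod_mod_cancel)
    also have "q * a - (q - 1) * y - 1 = (a - 1) + (q - 1) * (a - y)"
      by (simp add: algebra_simps)
    finally show ?thesis
      by simp
  qed
  have G2: "G (a, y) mod q = y mod q" for a y
  proof -
    have "G (a, y) mod q = (q * a - (q - 1) * y - 1 + 1) mod q"
      unfolding G_def prod.case
      by (metis mod_add_left_eq mod_mod_cancel dvd_triv_left)
    also have "q * a - (q - 1) * y - 1 + 1 = y + q * (a - y)"
      by (simp add: algebra_simps)
    finally show ?thesis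
      by simp
  qed
  have FG: "F (G (a, y)) = (a, y)" if "a \<in> {1..q - 1}" "y \<in> {1..q - 1}" for a y
    using that by (auto simp: F_def G1 G2)
  have Gran: "G z \<in> {1..q * (q - 1)}" for z
    using pos_mod_sign[OF pos] pos_mod_bound[OF pos] by (cases z) (simp add: G_def add1_zle_eq)
  have "bij_betw F ?S ?T"
  proof (rule bij_betw_byWitness[where f' = G])
    show "\<forall>x\<in>?S. G (F x) = x"
    proof
      fix x assume "x \<in> ?S"
      then have x: "x \<in> {1..q * (q - 1)}" by simp
      let ?z = "G (F x)"
      have "(?z - 1) mod (q - 1) = (x - 1) mod (q - 1)" "?z mod q = x mod q"
        by (simp_all add: F_def G1 G2)
      then have "q - 1 dvd ?z - x" "q dvd ?z - x"
        by (simp_all add: mod_eq_dvd_iff)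
      moreover have "coprime q (q - 1)"
        by simp
      ultimately have "q * (q - 1) dvd ?z - x"
        by (simp add: divides_mult)
      moreover have "\<bar>?z - x\<bar> < q * (q - 1)"
        using x Gran[of "F x"] by auto
      ultimately show "?z = x"
        using zdvd_imp_le[of "q * (q - 1)" "\<bar>?z - x\<bar>"] by fastforce
    qed
    show "\<forall>z\<in>?T. F (G z) = z"
      using FG by auto
    show "F ` ?S \<subseteq> ?T"
    proof
      fix z assume "z \<in> F ` ?S"
      then obtain x where x: "x \<in> ?S" "z = F x" by blast
      have "x mod q \<noteq> 0" using x by auto
      moreover have "0 \<le> x mod q" "x mod q < q"
        using assms by simp_all
      ultimately have "x mod q \<in> {1..q - 1}"
        by simp
      moreover have "(x - 1) mod (q - 1) + 1 \<in> {1..q - 1}"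
        using assms pos_mod_sign[of "q - 1" "x - 1"] pos_mod_bound[of "q - 1" "x - 1"]
        unfolding atLeastAtMost_iff by linarith
      ultimately show "z \<in> ?T" using x by (auto simp: F_def)
    qed
    show "G ` ?T \<subseteq> ?S"
    proof
      fix x assume "x \<in> G ` ?T"
      then obtain a y where ay: "a \<in> {1..q - 1}" "y \<in> {1..q - 1}" "Q a y" "x = G (a, y)" by blast
      have "(x - 1) mod (q - 1) + 1 = a" "x mod q = y"
        using FG[OF ay(1,2)] by (simp_all add: F_def ay(4))
      then show "x \<in> ?S" using ay Gran[of "(a, y)"] by (auto simp: dvd_eq_mod_eq_0)
    qed
  qed
  then have "card ?S = card ?T"
    by (rule bij_betw_same_card)
  also have "card ?T = (\<Sum>a = 1..q - 1. card {y \<in> {1..q - 1}. Q a y})"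
    by (intro card_SigmaI ballI finite_subset[OF _ finite_atLeastAtMost_int[of 1 "q - 1"]]) auto
  finally show ?thesis .
qed

text \<open>
  An integer of \<open>{1..d k}\<close> is determined by the block \<open>{d j + 1..d (j + 1)}\<close> that contains it and by its
  residue modulo \<open>d\<close>.
\<close>

lemma card_multiple_periods:
  fixes d k :: nat and R :: "int \<Rightarrow> bool"
  assumes "d > 0"
  shows "card {x \<in> {1..int d * int k}. R (x mod int d)} = k * card {z \<in> {0..<int d}. R z}"
proof -
  let ?S = "{x \<in> {1..int d * int k}. R (x mod int d)}"
  let ?T = "{0..<int k} \<times> {z \<in> {0..<int d}. R z}"
  define F where "F = (\<lambda>x. ((x - 1) div int d, x mod int d))"
  \<comment> \<open>The residue 0 belongs to the last element of a block, not the first: \<open>(z - 1) mod d\<close> is the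
      offset of the residue \<open>z\<close> from the start of the block.\<close>
  define G where "G = (\<lambda>(j, z). int d * j + (z - 1) mod int d + 1)"
  have "bij_betw F ?S ?T"
  proof (rule bij_betw_byWitness[where f' = G])
    show "\<forall>x\<in>?S. G (F x) = x"
      by (simp add: F_def G_def mod_diff_left_eq)
    show "\<forall>t\<in>?T. F (G t) = t"
    proof safe
      fix j z assume "z \<in> {0..<int d}"
      moreover have "(int d * j + (z - 1) mod int d + 1) mod int d = z mod int d"
        by (metis add.assoc diff_add_cancel mod_add_left_eq mod_mult_self4)
      ultimately show "F (G (j, z)) = (j, z)"
        using assms by (simp add: F_def G_def)
    qed
    show "F ` ?S \<subseteq> ?T"
    proof
      fix t assume "t \<in> F ` ?S"
      then obtain x where x: "x \<in> ?S" "t = F x" by blast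
      have "int d * ((x - 1) div int d) \<le> x - 1"
        using assms mult_div_mod_eq[of "int d" "x - 1"] pos_mod_sign[of "int d" "x - 1"] by linarith
      then have "int d * ((x - 1) div int d) < int d * int k"
        using x by auto
      then have "(x - 1) div int d < int k"
        using assms by (simp only: mult_less_cancel_left_pos of_nat_0_less_iff)
      moreover have "0 \<le> (x - 1) div int d"
        using x assms by (simp add: pos_imp_zdiv_nonneg_iff)
      ultimately show "t \<in> ?T" using x assms by (auto simp: F_def)
    qed
    show "G ` ?T \<subseteq> ?S"
    proof
      fix x assume "x \<in> G ` ?T"
      then obtain j z where jz: "0 \<le> j" "j < int k" "0 \<le> z" "z < int d" "R z"
        and x: "x = G (j, z)" by auto
      have r: "0 \<le> (z - 1) mod int d" "(z - 1) mod int d < int d"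
        using assms by simp_all
      have "int d * (j + 1) \<le> int d * int k"
        using jz by (intro mult_left_mono) auto
      then have "x \<le> int d * int k"
        using r by (simp add: x G_def algebra_simps)
      moreover have "1 \<le> x" using r jz by (simp add: x G_def)
      moreover have "x mod int d = z"
        using jz unfolding x G_def prod.case
        by (metis add.assoc diff_add_cancel mod_add_left_eq mod_mult_self4 mod_pos_pos_trivial)
      ultimately show "x \<in> ?S" using jz by simp
    qed
  qed
  then have "card ?S = card ?T"
    by (rule bij_betw_same_card)
  then show ?thesis by (simp add: card_cartesian_product)
qed

lemma card_poly_dvd_complete_periods:
  fixes f :: "int poly" and d n :: nat
  assumes "d dvd n" and "d > 0"
  shows "card {x \<in> {1..int n}. int d dvd poly f x} = (n div d) * num_roots_mod f d"
proof -
  have "[poly f x = 0] (mod int d) \<longleftrightarrow> [poly f (x mod int d) = 0] (mod int d)" for x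
    using cong_poly_int[of x "x mod int d" "int d" f] by (auto simp: cong_def)
  then have "{x \<in> {1..int n}. int d dvd poly f x} =
      {x \<in> {1..int d * int (n div d)}. [poly f (x mod int d) = 0] (mod int d)}"
    using assms by (simp add: cong_0_iff flip: of_nat_mult)
  then show ?thesis
    unfolding num_roots_mod_def
    using card_multiple_periods[OF assms(2), of "n div d" "\<lambda>z. [poly f z = 0] (mod int d)"]
    by simp
qed

section \<open>The two formulas\<close>

lemma sum_gcd_poly_eq_sum_divisors:
  fixes f :: "int poly" and n :: nat
  assumes "n > 0"
  shows "(\<Sum>x = 1..int n. gcd (int n) (poly f x)) =
           int (\<Sum>d | d dvd n. totient d * (n div d) * num_roots_mod f d)"
proof -
  have fin: "finite {d. d dvd n}"
    using assms by (rule finite_divisors_nat)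
  have "(\<Sum>x = 1..int n. gcd (int n) (poly f x)) =
      int (\<Sum>x = 1..int n. \<Sum>d | d dvd n \<and> int d dvd poly f x. totient d)"
    by (simp add: gcd_eq_sum_totient)
  also have "(\<Sum>x = 1..int n. \<Sum>d | d dvd n \<and> int d dvd poly f x. totient d) =
      (\<Sum>d | d dvd n. \<Sum>x | x \<in> {1..int n} \<and> int d dvd poly f x. totient d)"
    using sum.swap_restrict[OF _ fin, of "{1..int n}" "\<lambda>x d. totient d" "\<lambda>x d. int d dvd poly f x"]
    by simp
  also have "\<dots> = (\<Sum>d | d dvd n. totient d * (n div d) * num_roots_mod f d)"
  proof (rule sum.cong)
    fix d assume "d \<in> {d. d dvd n}"
    then have "d dvd n" "d > 0" using assms by (auto intro: Nat.gr0I)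
    from card_poly_dvd_complete_periods[OF this, of f]
    show "(\<Sum>x | x \<in> {1..int n} \<and> int d dvd poly f x. totient d) =
        totient d * (n div d) * num_roots_mod f d" by simp
  qed simp
  finally show ?thesis .
qed

lemma card_power_mod_int_fixed_points:
  fixes p :: nat and g :: "int poly"
  assumes "prime p"
  shows "int (card {x :: int. 1 \<le> x \<and> x \<le> int p * (int p - 1) \<and> \<not> int p dvd x \<and>
                       [power_mod_int (int p) x (poly g x) = x] (mod int p)}) =
           (\<Sum>x0 = 1..int p - 1. gcd (int p - 1) (poly g x0 - 1))"
proof -
  have p: "p > 1"
    using assms by (rule prime_gt_1_nat)
  define Q where "Q = (\<lambda>a y. int (ord p (nat y)) dvd poly g a - 1)"
  \<comment> \<open>The congruence only sees \<open>x\<close> modulo \<open>p\<close> and modulo \<open>p - 1\<close>: replacing the argument of \<open>g\<close> by \<open>a\<close>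
      changes the exponent by a multiple of \<open>p - 1\<close>, hence of the order \<open>h\<close>.\<close>
  have key: "[power_mod_int (int p) x (poly g x) = x] (mod int p) \<longleftrightarrow>
      Q ((x - 1) mod (int p - 1) + 1) (x mod int p)" if x: "\<not> int p dvd x" for x
  proof -
    define a where "a = (x - 1) mod (int p - 1) + 1"
    define h where "h = ord p (nat (x mod int p))"
    have "coprime (int p) (x mod int p)"
      using x assms by (metis coprime_mod_right_iff not_prime_0 of_nat_eq_0_iff prime_imp_coprime
        prime_nat_int_transfer)
    then have "coprime p (nat (x mod int p))"
      using p by (metis coprime_int_iff int_nat_eq pos_mod_sign of_nat_0_less_iff less_trans zero_less_one)
    then have "h dvd p - 1"
      unfolding h_def using order_divides_totient[of p "nat (x mod int p)"] assms
      by (simp add: totient_prime)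
    then have "int h dvd int p - 1"
      using p by (metis int_dvd_int_iff of_nat_1 of_nat_diff less_imp_le)
    moreover have "[x = a] (mod (int p - 1))"
      unfolding a_def by (simp add: cong_def mod_add_left_eq)
    ultimately have "[poly g x = poly g a] (mod int h)"
      by (intro cong_poly_int) (metis cong_dvd_modulus)
    then have "int h dvd poly g x - 1 \<longleftrightarrow> int h dvd poly g a - 1"
      by (metis cong_diff cong_refl cong_dvd_iff)
    then show ?thesis
      using power_mod_int_cong_self_iff[OF assms x, of "poly g x"] by (simp add: Q_def h_def a_def)
  qed
  have "{x :: int. 1 \<le> x \<and> x \<le> int p * (int p - 1) \<and> \<not> int p dvd x \<and>
           [power_mod_int (int p) x (poly g x) = x] (mod int p)} =
        {x \<in> {1..int p * (int p - 1)}. \<not> int p dvd x \<and>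
           Q ((x - 1) mod (int p - 1) + 1) (x mod int p)}"
    using key by auto
  also have "card \<dots> = (\<Sum>a = 1..int p - 1. card {y \<in> {1..int p - 1}. Q a y})"
    using p by (intro card_residue_pairs) simp
  also have "int \<dots> = (\<Sum>a = 1..int p - 1. gcd (int p - 1) (poly g a - 1))"
    unfolding of_nat_sum
  proof (rule sum.cong)
    fix a
    have "{y \<in> {1..int p - 1}. Q a y} =
        int ` {y \<in> totatives p. int (ord p y) dvd poly g a - 1}"
    proof
      show "{y \<in> {1..int p - 1}. Q a y} \<subseteq> int ` {y \<in> totatives p. int (ord p y) dvd poly g a - 1}"
        using assms by (auto simp: Q_def totatives_prime intro!: image_eqI[of _ _ "nat y" for y])
    qed (use assms in \<open>auto simp: Q_def totatives_prime\<close>)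
    then have "card {y \<in> {1..int p - 1}. Q a y} =
        card {y \<in> totatives p. int (ord p y) dvd poly g a - 1}"
      by (simp add: card_image)
    then show "int (card {y \<in> {1..int p - 1}. Q a y}) = gcd (int p - 1) (poly g a - 1)"
      using card_ord_dvd_eq_gcd[OF assms] by simp
  qed simp
  finally show ?thesis .
qed

theorem corollary5:
  fixes p :: nat and g :: "int poly"
  assumes "prime p"
  shows "int (card {x :: int. 1 \<le> x \<and> x \<le> int p * (int p - 1) \<and> \<not> int p dvd x \<and>
                       [power_mod_int (int p) x (poly g x) = x] (mod int p)})
           = (\<Sum>x0 = 1..int p - 1. gcd (int p - 1) (poly g x0 - 1))
       \<and> (\<Sum>x0 = 1..int p - 1. gcd (int p - 1) (poly g x0 - 1))
           = int (\<Sum>d | d dvd p - 1. totient d * ((p - 1) div d) * num_roots_mod (g - 1) d)"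
proof
  have p: "p > 1"
    using assms by (rule prime_gt_1_nat)
  then show "(\<Sum>x0 = 1..int p - 1. gcd (int p - 1) (poly g x0 - 1))
      = int (\<Sum>d | d dvd p - 1. totient d * ((p - 1) div d) * num_roots_mod (g - 1) d)"
    using sum_gcd_poly_eq_sum_divisors[of "p - 1" "g - 1"] by (simp add: of_nat_diff)
qed (rule card_power_mod_int_fixed_points[OF assms])

end
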